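(* Let $U$, $H=(L_2(\Omega))^m$, $\mathcal D\colon U\to H$, $Y$, and the bilinear forms $\langle\cdot,\cdot\rangle_y$ ($y\in Y$) on $H$ be as in the context, and assume there are constants $0<c_U\le C_U<\infty$ such that $$c_U\|u\|_U^2\le\langle\mathcal D u,\mathcal D u\rangle_y\le C_U\|u\|_U^2\qquad\text{for all }u\in U,\ y\in Y .$$ Let $(\Phi_J)_{J\in\mathbb N}$ be a family of frames $\Phi=\Phi_J=\{\varphi_i: i\in\mathcal I\}$ (with finite index set $\mathcal I=\mathcal I_J$) for $U_\Phi=\operatorname{span}\Phi\subset U$ with frame constants $c_{\Phi_J},C_{\Phi_J}>0$ satisfying $\sup_{J\in\mathbb N}C_{\Phi_J}/c_{\Phi_J}<\infty$. Let $F\colon\ell_2(\mathcal I)\to U$, $F\mathbf v=\sum_{i\in\mathcal I}\mathbf v_i\varphi_i$, and $H_\Phi=\operatorname{ran}(\mathcal D F)\subset H$. For each $J$, let $\{\chi_n: n\in\mathcal N\}$, with finite index set $\mathcal N=\mathcal N_J$, be a frame for $H_\Phi$, and let $G\colon H_\Phi\to\ell_2(\mathcal N)$ be an injective linear mapping that is well-conditioned, uniformly in $J$, from $H_\Phi$ to $\operatorname{ran}G$ and satisfies $$h=\sum_{n\in\mathcal N}(Gh)_n\,\chi_n\qquad\text{for all }h\in H_\Phi .$$ Define $$\mathbf D=G\,\mathcal D\,F\colon \ell_2(\mathcal I)\to\ell_2(\mathcal N),\qquad \mathbf C_y=\bigl(\langle\chi_n,\chi_{n'}\rangle_y\bigr)_{n,n'\in\mathcal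 N}.$$ Then the condition numbers of $\mathbf D$ and of $\mathbf C_y$ are bounded uniformly in $J\in\mathbb N$ and $y\in Y$.
   Context: $\Omega\subset\mathbb R^d$ is a domain, $Y$ is a parameter set, $U$ is a real Hilbert space, and $H=(L_2(\Omega))^m$ for some $m\in\mathbb N$. The linear map $\mathcal D\colon U\to H$ does not depend on $y$, is bounded and injective, and is an isomorphism from $U$ onto $\operatorname{ran}(\mathcal D)\subset H$. For each $y\in Y$, $\langle\cdot,\cdot\rangle_y$ is a bilinear form on $H$ that may depend on $y$. Frame: for a Hilbert space $X$, a family $\Psi=\{\psi_i : i\in\mathcal K\}\subset X$ is a frame for $X_\Psi=\overline{\operatorname{span}\Psi}\subset X$ (with the norm of $X$) with frame constants $c_\Psi,C_\Psi>0$ if $$c_\Psi^2\|h\|_{X_\Psi'}^2\le\sum_{i\in\mathcal K}|h(\psi_i)|^2\le C_\Psi^2\|h\|_{X_\Psi'}^2\quad\text{for all }h\in X_\Psi',$$ where $X_\Psi'$ is the dual space of $X_\Psi$ with its dual norm. For $\Phi$ this is used with $X=U$, and for $\{\chi_n\}$ with $X=H$. Frames may be overcomplete. That $G$ is well-conditioned uniformly in $J$ from $H_\Phi$ to $\operatorname{ran}G$ means that $\|G\|\,\|G^{-1}|_{\operatorname{ran}G}\|$ is bounded independently of $J$. Since frames may be overcomplete, $\mathbf D$ and $\mathbf C_y$ may have nontrivial kernels; the condition number of a matrix is understood as the ratio of its largest to its smallest nonzero singular value.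
   Formalization: Two hypotheses are added, without which the claim for C_y fails: the frame constants of {χ_n} have ratio bounded uniformly in J, and |⟨Du,Dv⟩_y| ≤ M‖u‖‖v‖ with M independent of y (automatic if the forms are symmetric). *)

theory Defs
  imports "HOL-Analysis.Analysis"
begin

section \<open>The space \<open>(L\<^sub>2(\<Omega>))\<^sup>m\<close>\<close>

definition square_integrable :: "('a::euclidean_space \<Rightarrow> real) \<Rightarrow> bool" where
  "square_integrable f \<longleftrightarrow>
     f \<in> borel_measurable lebesgue \<and> integrable lebesgue (\<lambda>x. (f x)\<^sup>2)"

definition L2_rel :: "('a::euclidean_space \<Rightarrow> real) \<Rightarrow> ('a \<Rightarrow> real) \<Rightarrow> bool" where
  "L2_rel f g \<longleftrightarrow> square_integrable f \<and> square_integrable g \<and> (AE x in lebesgue. f x = g x)"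

lemma square_integrable_measurable:
  "square_integrable f \<Longrightarrow> f \<in> borel_measurable lebesgue"
  by (simp add: square_integrable_def)

lemma square_integrable_zero: "square_integrable (\<lambda>_. 0)"
  by (simp add: square_integrable_def)

lemma square_integrable_mult:
  assumes "square_integrable f" "square_integrable g"
  shows "integrable lebesgue (\<lambda>x. f x * g x)"
proof (rule Bochner_Integration.integrable_bound)
  show "integrable lebesgue (\<lambda>x. (f x)\<^sup>2 + (g x)\<^sup>2)"
    using assms by (auto simp: square_integrable_def)
  show "(\<lambda>x. f x * g x) \<in> borel_measurable lebesgue"
    using assms by (auto simp: square_integrable_def)
  have "\<bar>a * b\<bar> \<le> a\<^sup>2 + b\<^sup>2" for a b :: real
  proof -
    have "2 * \<bar>a\<bar> * \<bar>b\<bar> \<le> a\<^sup>2 + b\<^sup>2"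
      using sum_squares_bound[of "\<bar>a\<bar>" "\<bar>b\<bar>"] by simp
    moreover have "0 \<le> \<bar>a\<bar> * \<bar>b\<bar>" by simp
    ultimately show ?thesis unfolding abs_mult by linarith
  qed
  then show "AE x in lebesgue. norm (f x * g x) \<le> norm ((f x)\<^sup>2 + (g x)\<^sup>2)"
    by auto
qed

lemma square_integrable_add:
  assumes "square_integrable f" "square_integrable g"
  shows "square_integrable (\<lambda>x. f x + g x)"
  using assms square_integrable_mult[OF assms]
  by (auto simp: square_integrable_def power2_sum mult.assoc)

lemma square_integrable_scale:
  "square_integrable f \<Longrightarrow> square_integrable (\<lambda>x. c * f x)"
  by (auto simp: square_integrable_def power_mult_distrib)

lemma square_integrable_uminus:
  "square_integrable f \<Longrightarrow> square_integrable (\<lambda>x. - f x)"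
  using square_integrable_scale[of f "-1"] by simp

lemma square_integrable_diff:
  "square_integrable f \<Longrightarrow> square_integrable g \<Longrightarrow> square_integrable (\<lambda>x. f x - g x)"
  using square_integrable_add[OF _ square_integrable_uminus] by fastforce

quotient_type (overloaded) 'a L2 = "'a::euclidean_space \<Rightarrow> real" / partial: L2_rel
proof (rule part_equivpI)
  show "\<exists>f::'a \<Rightarrow> real. L2_rel f f"
    using square_integrable_zero by (auto simp: L2_rel_def)
  show "symp (L2_rel :: ('a \<Rightarrow> real) \<Rightarrow> _)"
    by (auto simp: symp_def L2_rel_def elim: AE_mp)
  show "transp (L2_rel :: ('a \<Rightarrow> real) \<Rightarrow> _)"
  proof (rule transpI)
    fix f g h :: "'a \<Rightarrow> real"
    assume *: "L2_rel f g" "L2_rel g h"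
    then have "AE x in lebesgue. f x = g x" "AE x in lebesgue. g x = h x"
      by (auto simp: L2_rel_def)
    then have "AE x in lebesgue. f x = h x" by eventually_elim simp
    with * show "L2_rel f h" by (auto simp: L2_rel_def)
  qed
qed

instantiation L2 :: (euclidean_space) real_vector
begin

lift_definition zero_L2 :: "'a L2" is "\<lambda>_. 0"
  by (simp add: L2_rel_def square_integrable_zero)

lift_definition plus_L2 :: "'a L2 \<Rightarrow> 'a L2 \<Rightarrow> 'a L2" is "\<lambda>f g x. f x + g x"
  unfolding L2_rel_def by (auto intro: square_integrable_add elim: eventually_elim2)

lift_definition scaleR_L2 :: "real \<Rightarrow> 'a L2 \<Rightarrow> 'a L2" is "\<lambda>c f x. c * f x"
  unfolding L2_rel_def by (auto intro: square_integrable_scale elim: eventually_mono)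

lift_definition uminus_L2 :: "'a L2 \<Rightarrow> 'a L2" is "\<lambda>f x. - f x"
  unfolding L2_rel_def by (auto intro: square_integrable_uminus elim: eventually_mono)

lift_definition minus_L2 :: "'a L2 \<Rightarrow> 'a L2 \<Rightarrow> 'a L2" is "\<lambda>f g x. f x - g x"
  unfolding L2_rel_def by (auto intro: square_integrable_diff elim: eventually_elim2)

instance
proof
  fix f g h :: "'a L2" and r s :: real
  show "f + g + h = f + (g + h)"
    by transfer (auto simp: L2_rel_def add.assoc intro!: square_integrable_add)
  show "f + g = g + f"
    by transfer (auto simp: L2_rel_def add.commute intro!: square_integrable_add)
  show "0 + f = f"
    by transfer (auto simp: L2_rel_def)
  show "- f + f = 0"
    by transfer (auto simp: L2_rel_def square_integrable_zero)
  show "f - g = f + - g"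
    by transfer (auto simp: L2_rel_def intro!: square_integrable_diff)
  show "r *\<^sub>R (f + g) = r *\<^sub>R f + r *\<^sub>R g"
    by transfer (auto simp: L2_rel_def distrib_left
        intro!: square_integrable_add square_integrable_scale)
  show "(r + s) *\<^sub>R f = r *\<^sub>R f + s *\<^sub>R f"
    by transfer (auto simp: L2_rel_def distrib_right
        intro!: square_integrable_add square_integrable_scale)
  show "r *\<^sub>R s *\<^sub>R f = (r * s) *\<^sub>R f"
    by transfer (auto simp: L2_rel_def mult.assoc intro!: square_integrable_scale)
  show "1 *\<^sub>R f = f"
    by transfer (auto simp: L2_rel_def)
qed

end

instantiation L2 :: (euclidean_space) real_inner
begin

lift_definition inner_L2 :: "'a L2 \<Rightarrow> 'a L2 \<Rightarrow> real"
  is "\<lambda>f g. integral\<^sup>L lebesgue (\<lambda>x. f x * g x)"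
proof -
  fix f f' g g' :: "'a \<Rightarrow> real"
  assume *: "L2_rel f f'" "L2_rel g g'"
  then have "AE x in lebesgue. f x = f' x" "AE x in lebesgue. g x = g' x"
    by (auto simp: L2_rel_def)
  then have "AE x in lebesgue. f x * g x = f' x * g' x" by eventually_elim simp
  with * show "integral\<^sup>L lebesgue (\<lambda>x. f x * g x) = integral\<^sup>L lebesgue (\<lambda>x. f' x * g' x)"
    by (intro integral_cong_AE)
       (auto simp: L2_rel_def dest!: square_integrable_measurable)
qed

definition norm_L2 :: "'a L2 \<Rightarrow> real" where "norm_L2 f = sqrt (inner f f)"
definition sgn_L2 :: "'a L2 \<Rightarrow> 'a L2" where "sgn_L2 f = f /\<^sub>R norm f"
definition dist_L2 :: "'a L2 \<Rightarrow> 'a L2 \<Rightarrow> real" where "dist_L2 f g = norm (f - g)"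
definition uniformity_L2 :: "('a L2 \<times> 'a L2) filter" where
  "uniformity_L2 = (INF e\<in>{0<..}. principal {(x, y). dist x y < e})"
definition open_L2 :: "'a L2 set \<Rightarrow> bool" where
  "open_L2 U = (\<forall>x\<in>U. eventually (\<lambda>(x', y). x' = x \<longrightarrow> y \<in> U) uniformity)"

instance
proof
  fix f g h :: "'a L2" and r :: real
  show "dist f g = norm (f - g)" by (rule dist_L2_def)
  show "sgn f = f /\<^sub>R norm f" by (rule sgn_L2_def)
  show "uniformity = (INF e\<in>{0<..}. principal {(x :: 'a L2, y). dist x y < e})"
    by (rule uniformity_L2_def)
  show "open U = (\<forall>x\<in>U. eventually (\<lambda>(x', y). x' = x \<longrightarrow> y \<in> U) uniformity)"
    for U :: "'a L2 set" by (rule open_L2_def)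
  show "inner f g = inner g f"
    by transfer (simp add: mult.commute)
  show "inner (f + g) h = inner f h + inner g h"
    by transfer (auto simp: L2_rel_def distrib_right
        intro!: Bochner_Integration.integral_add square_integrable_mult)
  show "inner (r *\<^sub>R f) g = r * inner f g"
    by transfer (simp add: mult.assoc)
  show "0 \<le> inner f f"
    by transfer simp
  show "inner f f = 0 \<longleftrightarrow> f = 0"
  proof transfer
    fix f :: "'a \<Rightarrow> real"
    assume "L2_rel f f"
    then have f: "square_integrable f" by (simp add: L2_rel_def)
    have "integral\<^sup>L lebesgue (\<lambda>x. f x * f x) = 0 \<longleftrightarrow> (AE x in lebesgue. f x * f x = 0)"
      by (rule integral_nonneg_eq_0_iff_AE) (auto intro: square_integrable_mult f)
    then show "integral\<^sup>L lebesgue (\<lambda>x. f x * f x) = 0 \<longleftrightarrow> L2_rel f (\<lambda>_. 0)"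
      using f by (simp add: L2_rel_def square_integrable_zero)
  qed
  show "norm f = sqrt (inner f f)" by (rule norm_L2_def)
qed

end

text \<open>
  The type \<open>'a L2\<close> is \<open>L\<^sub>2\<close> of the whole space. \<open>L\<^sub>2(\<Omega>)\<close> is identified, by extension
  with zero, with the subspace of those classes that vanish almost everywhere outside \<open>\<Omega>\<close>;
  norm and inner product agree with those of \<open>L\<^sub>2(\<Omega>)\<close>. The norm on \<open>('a L2)^'m\<close> is the
  Hilbert space norm of the product.
\<close>

lift_definition vanishes_outside :: "'a::euclidean_space set \<Rightarrow> 'a L2 \<Rightarrow> bool"
  is "\<lambda>\<Omega> f. AE x in lebesgue. x \<notin> \<Omega> \<longrightarrow> f x = 0"
proof -
  fix \<Omega> :: "'a set" and f g :: "'a \<Rightarrow> real"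
  assume "L2_rel f g"
  then have *: "AE x in lebesgue. f x = g x" by (simp add: L2_rel_def)
  then have "AE x in lebesgue. (x \<notin> \<Omega> \<longrightarrow> f x = 0) \<longleftrightarrow> (x \<notin> \<Omega> \<longrightarrow> g x = 0)"
    by eventually_elim simp
  then show "(AE x in lebesgue. x \<notin> \<Omega> \<longrightarrow> f x = 0) = (AE x in lebesgue. x \<notin> \<Omega> \<longrightarrow> g x = 0)"
    by (rule eventually_subst)
qed

definition L2_space :: "'a::euclidean_space set \<Rightarrow> (('a L2)^'m) set" where
  "L2_space \<Omega> = {h. \<forall>k. vanishes_outside \<Omega> (h $ k)}"


section \<open>Linear maps and forms on subspaces\<close>

definition linear_on :: "'x::real_vector set \<Rightarrow> ('x \<Rightarrow> real) \<Rightarrow> bool" where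
  "linear_on S f \<longleftrightarrow>
     (\<forall>x\<in>S. \<forall>y\<in>S. f (x + y) = f x + f y) \<and> (\<forall>c. \<forall>x\<in>S. f (c *\<^sub>R x) = c * f x)"

definition bilinear_on :: "'x::real_vector set \<Rightarrow> ('x \<Rightarrow> 'x \<Rightarrow> real) \<Rightarrow> bool" where
  "bilinear_on S b \<longleftrightarrow> (\<forall>x\<in>S. linear_on S (b x) \<and> linear_on S (\<lambda>z. b z x))"

definition op_norm_on :: "'x set \<Rightarrow> ('x \<Rightarrow> real) \<Rightarrow> ('z \<Rightarrow> real) \<Rightarrow> ('x \<Rightarrow> 'z) \<Rightarrow> real" where
  "op_norm_on S normX normZ f = (SUP x\<in>{x\<in>S. normX x \<le> 1}. normZ (f x))"

definition isomorphism_onto_range :: "('u::real_normed_vector \<Rightarrow> 'x::real_normed_vector) \<Rightarrow> bool" where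
  "isomorphism_onto_range T \<longleftrightarrow>
     bounded_linear T \<and> inj T \<and> (\<exists>K. \<forall>x\<in>range T. norm (inv T x) \<le> K * norm x)"


section \<open>Frames\<close>

definition dual_space :: "'x::real_normed_vector set \<Rightarrow> ('x \<Rightarrow> real) set" where
  "dual_space S = {h. linear_on S h \<and> (\<exists>B. \<forall>x\<in>S. \<bar>h x\<bar> \<le> B * norm x)}"

definition dual_norm :: "'x::real_normed_vector set \<Rightarrow> ('x \<Rightarrow> real) \<Rightarrow> real" where
  "dual_norm S h = op_norm_on S norm abs h"

text \<open>
  A functional in \<open>dual_space S\<close> is a function on the whole type, of which only the values on
  \<open>S\<close> matter. For finite \<open>K\<close> the span is already closed.
\<close>

definition frame_for ::
  "'x::real_normed_vector set \<Rightarrow> 'k set \<Rightarrow> ('k \<Rightarrow> 'x) \<Rightarrow> real \<Rightarrow> real \<Rightarrow> bool" where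
  "frame_for S K \<psi> c C \<longleftrightarrow>
     S = closure (span (\<psi> ` K)) \<and> 0 < c \<and> 0 < C \<and>
     (\<forall>h\<in>dual_space S. (\<lambda>i. \<bar>h (\<psi> i)\<bar>\<^sup>2) summable_on K \<and>
        c\<^sup>2 * (dual_norm S h)\<^sup>2 \<le> (\<Sum>\<^sub>\<infinity>i\<in>K. \<bar>h (\<psi> i)\<bar>\<^sup>2) \<and>
        (\<Sum>\<^sub>\<infinity>i\<in>K. \<bar>h (\<psi> i)\<bar>\<^sup>2) \<le> C\<^sup>2 * (dual_norm S h)\<^sup>2)"


section \<open>Coefficient vectors and matrices over finite index sets\<close>

text \<open>
  For finite \<open>K\<close>, the space \<open>\<ell>\<^sub>2(K)\<close> consists of the functions supported in \<open>K\<close>,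
  and its norm is \<open>\<lambda>v. L2_set v K\<close>.
\<close>

definition ell2 :: "'k set \<Rightarrow> ('k \<Rightarrow> real) set" where
  "ell2 K = {v. \<forall>i. i \<notin> K \<longrightarrow> v i = 0}"

definition synthesis :: "'k set \<Rightarrow> ('k \<Rightarrow> 'x::real_vector) \<Rightarrow> ('k \<Rightarrow> real) \<Rightarrow> 'x" where
  "synthesis K \<psi> v = (\<Sum>i\<in>K. v i *\<^sub>R \<psi> i)"

definition matrix_of :: "(('i \<Rightarrow> real) \<Rightarrow> ('n \<Rightarrow> real)) \<Rightarrow> 'n \<Rightarrow> 'i \<Rightarrow> real" where
  "matrix_of T n i = T (\<lambda>k. if k = i then 1 else 0) n"

definition gram_matrix :: "('x \<Rightarrow> 'x \<Rightarrow> real) \<Rightarrow> ('n \<Rightarrow> 'x) \<Rightarrow> 'n \<Rightarrow> 'n \<Rightarrow> real" where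
  "gram_matrix b chi n n' = b (chi n) (chi n')"

text \<open>The square roots of the nonzero eigenvalues of \<open>A\<^sup>T A\<close>, where \<open>A\<close> has rows \<open>N\<close> and columns \<open>I\<close>.\<close>

definition nonzero_singular_values :: "'n set \<Rightarrow> 'i set \<Rightarrow> ('n \<Rightarrow> 'i \<Rightarrow> real) \<Rightarrow> real set" where
  "nonzero_singular_values N I A =
     {\<sigma>. 0 < \<sigma> \<and> (\<exists>v\<in>ell2 I. v \<noteq> (\<lambda>_. 0) \<and>
        (\<forall>i\<in>I. (\<Sum>n\<in>N. A n i * (\<Sum>j\<in>I. A n j * v j)) = \<sigma>\<^sup>2 * v i))}"

text \<open>A zero matrix has no nonzero singular value; its condition number is set to \<open>1\<close>.\<close>

definition condition_number :: "'n set \<Rightarrow> 'i set \<Rightarrow> ('n \<Rightarrow> 'i \<Rightarrow> real) \<Rightarrow> real" where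
  "condition_number N I A =
     (let S = nonzero_singular_values N I A in if S = {} then 1 else Max S / Min S)"


section \<open>Symmetric forms\<close>

text \<open>
  For a symmetric form, the bounds on the diagonal already give a bound for all pairs
  of arguments. Without symmetry they say nothing about the antisymmetric part of the form.
\<close>

lemma symmetric_form_bounded:
  fixes b :: "'x::real_vector \<Rightarrow> 'x \<Rightarrow> real" and T :: "'u::real_normed_vector \<Rightarrow> 'x"
  assumes T: "linear T" "range T \<subseteq> S"
    and b: "bilinear_on S b" "\<And>g h. g \<in> S \<Longrightarrow> h \<in> S \<Longrightarrow> b g h = b h g"
    and diag: "\<And>u. 0 \<le> b (T u) (T u)" "\<And>u. b (T u) (T u) \<le> C * (norm u)\<^sup>2"
    and C: "0 < C"
  shows "\<bar>b (T u) (T v)\<bar> \<le> C * norm u * norm v"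
proof -
  define q where "q u v = b (T u) (T v)" for u v
  have S: "T u \<in> S" for u using T by auto
  have add: "b (x + y) z = b x z + b y z" "b z (x + y) = b z x + b z y"
    if "x \<in> S" "y \<in> S" "z \<in> S" for x y z
    using b(1) that by (auto simp: bilinear_on_def linear_on_def)
  have scale: "b (r *\<^sub>R x) z = r * b x z" "b z (r *\<^sub>R x) = r * b z x"
    if "x \<in> S" "z \<in> S" for x z r
    using b(1) that by (auto simp: bilinear_on_def linear_on_def)
  have q_add: "q (u + v) w = q u w + q v w" "q w (u + v) = q w u + q w v" for u v w
    using S by (simp_all add: q_def linear_add[OF T(1)] add)
  have q_scale: "q (r *\<^sub>R u) w = r * q u w" "q w (r *\<^sub>R u) = r * q w u" for u w r
    using S by (simp_all add: q_def linear_scale[OF T(1)] scale)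
  have q_sym: "q u v = q v u" for u v using b(2) S by (simp add: q_def)
  have expand: "q (u + t *\<^sub>R v) (u + t *\<^sub>R v) = q u u + 2 * t * q u v + t\<^sup>2 * q v v" for u v t
    using q_sym[of v u] by (simp add: q_add q_scale power2_eq_square algebra_simps)
  have nonneg: "0 \<le> q u u + 2 * t * q u v + t\<^sup>2 * q v v" for u v t
    using diag(1)[of "u + t *\<^sub>R v"] expand[of u t v] by (simp add: q_def)
  have bound: "q u u \<le> C * (norm u)\<^sup>2" for u using diag(2) by (simp add: q_def)
  have unit: "\<bar>q u v\<bar> \<le> C" if "norm u = 1" "norm v = 1" for u v
    using nonneg[of u 1 v] nonneg[of u "-1" v] bound[of u] bound[of v] that by simp
  show ?thesis
  proof (cases "u = 0 \<or> v = 0")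
    case True
    then have "q u v = 0" using q_scale(1)[of 0 u v] q_scale(2)[of u 0 v] by auto
    then show ?thesis using True by (auto simp: q_def)
  next
    case False
    define u' v' where "u' = u /\<^sub>R norm u" and "v' = v /\<^sub>R norm v"
    have "q u v = q (norm u *\<^sub>R u') (norm v *\<^sub>R v')" using False by (simp add: u'_def v'_def)
    also have "\<dots> = norm u * norm v * q u' v'" by (simp add: q_scale mult.assoc)
    finally have "\<bar>q u v\<bar> = norm u * norm v * \<bar>q u' v'\<bar>" by (simp add: abs_mult)
    also have "\<dots> \<le> norm u * norm v * C"
      using unit[of u' v'] False by (intro mult_left_mono) (auto simp: u'_def v'_def)
    finally show ?thesis by (simp add: q_def mult_ac)
  qed
qed

end

theory Submission
  imports Defs
begin

text \<open>
  If \<open>A\<^sup>T A v = \<sigma>\<^sup>2 v\<close> with \<open>\<sigma> > 0\<close>, where \<open>A\<close> is \<open>\<^bold>D\<close> or \<open>\<^bold>C\<^sub>y\<close>, then \<open>v\<close> is \<open>\<sigma>\<^sup>-\<^sup>2 A\<^sup>T\<close> applied to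
  \<open>A v\<close>, hence consists of the values of one bounded functional on the frame. Testing that functional
  with the synthesis \<open>s\<close> of \<open>v\<close>, the lower frame bound gives \<open>c \<bar>v\<bar> \<le> \<bar>s\<bar>\<close>; always
  \<open>\<bar>s\<bar> \<le> C \<bar>v\<bar>\<close>. So \<open>\<sigma> = \<bar>A v\<bar> / \<bar>v\<bar>\<close> is controlled by the bounds of \<open>G\<close>, \<open>\<D>\<close> and their inverses
  for \<open>\<^bold>D\<close>, and by boundedness and coercivity of the form for \<open>\<^bold>C\<^sub>y\<close>, which
  yields \<open>cond \<^bold>D \<le> cond G \<cdot> cond \<D> \<cdot> C/c\<close> and \<open>cond \<^bold>C\<^sub>y \<le> (M/m) (C/c)\<^sup>2\<close>.
\<close>

section \<open>Singular values\<close>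

lemma L2_set_power2: "(L2_set f A)\<^sup>2 = (\<Sum>i\<in>A. (f i)\<^sup>2)"
  by (simp add: L2_set_def sum_nonneg)

lemma sum_mult_le_L2_set:
  "(\<Sum>i\<in>A. f i * g i) \<le> L2_set f A * L2_set g A" for f g :: "'k \<Rightarrow> real"
proof -
  have "(\<Sum>i\<in>A. f i * g i) \<le> (\<Sum>i\<in>A. \<bar>f i\<bar> * \<bar>g i\<bar>)"
    by (intro sum_mono) (metis abs_ge_self abs_mult)
  then show ?thesis
    using L2_set_mult_ineq[of f g A] by linarith
qed

lemma L2_set_pos_if_ell2:
  assumes "finite K" "v \<in> ell2 K" "v \<noteq> (\<lambda>_. 0)"
  shows "0 < L2_set v K"
proof (rule ccontr)
  assume "\<not> 0 < L2_set v K"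
  then have "L2_set v K = 0"
    using L2_set_nonneg[of v K] by linarith
  then have "v = (\<lambda>_. 0)"
    using assms(1,2) by (auto simp: L2_set_eq_0_iff ell2_def)
  with assms(3) show False ..
qed

text \<open>The eigenvalue equation divided by \<sigma>^2 displays \<open>v\<close> as a combination
  of the rows of \<open>A\<close> with weights \<open>z\<close>; this later makes \<open>v\<close>
  the values of one functional. Pairing the equation with \<open>v\<close> gives |A v| = \<sigma>
  |v|.\<close>

lemma nonzero_singular_valueE:
  assumes "\<sigma> \<in> nonzero_singular_values N I A" "finite N" "finite I"
  obtains v z where "0 < \<sigma>" "0 < L2_set v I" "\<And>n. z n = (\<Sum>j\<in>I. A n j * v j)"
    "\<And>i. i \<in> I \<Longrightarrow> v i = (\<Sum>n\<in>N. A n i * z n) / \<sigma>\<^sup>2" "L2_set z N = \<sigma> * L2_set v I"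
proof -
  from assms(1) obtain v where \<sigma>: "0 < \<sigma>" and v: "v \<in> ell2 I" "v \<noteq> (\<lambda>_. 0)"
    and ev: "\<And>i. i \<in> I \<Longrightarrow> (\<Sum>n\<in>N. A n i * (\<Sum>j\<in>I. A n j * v j)) = \<sigma>\<^sup>2 * v i"
    by (auto simp: nonzero_singular_values_def)
  define z where "z n = (\<Sum>j\<in>I. A n j * v j)" for n
  have "(L2_set z N)\<^sup>2 = (\<Sum>n\<in>N. \<Sum>j\<in>I. A n j * v j * z n)"
    unfolding L2_set_power2 by (simp add: power2_eq_square sum_distrib_right[symmetric] z_def)
  also have "\<dots> = (\<Sum>j\<in>I. v j * (\<Sum>n\<in>N. A n j * z n))"
    by (subst sum.swap) (simp add: sum_distrib_left mult_ac)
  also have "\<dots> = (\<Sum>j\<in>I. \<sigma>\<^sup>2 * (v j)\<^sup>2)"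
    using ev by (intro sum.cong) (simp_all add: z_def power2_eq_square)
  also have "\<dots> = (\<sigma> * L2_set v I)\<^sup>2"
    by (simp add: power_mult_distrib L2_set_power2 sum_distrib_left)
  finally have "L2_set z N = \<sigma> * L2_set v I"
    using \<sigma> by (simp add: L2_set_nonneg)
  moreover have "v i = (\<Sum>n\<in>N. A n i * z n) / \<sigma>\<^sup>2" if "i \<in> I" for i
    using ev[OF that] \<sigma> by (simp add: z_def)
  ultimately show thesis
    using that \<sigma> L2_set_pos_if_ell2[OF assms(3) v] z_def by blast
qed

text \<open>Bessel's inequality for the \<open>k\<close>-th unit vector bounds the sum of the
  squared \<open>k\<close>-th entries by 1. Adding over \<open>k\<close> counts the vectors, since
  each has norm 1.\<close>

lemma card_orthonormal_le:
  fixes w :: "'s \<Rightarrow> 'k \<Rightarrow> real"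
  assumes "finite K" "finite T"
    and orth: "\<And>s t. s \<in> T \<Longrightarrow> t \<in> T \<Longrightarrow> (\<Sum>i\<in>K. w s i * w t i) = (if s = t then 1 else 0)"
  shows "card T \<le> card K"
proof -
  have bessel: "(\<Sum>s\<in>T. (w s k)\<^sup>2) \<le> 1" if k: "k \<in> K" for k
  proof -
    \<comment> \<open>\<open>p\<close> is the orthogonal projection of the \<open>k\<close>-th unit
      vector onto the span of the \<open>w s\<close>, so its squared norm equals its own
      \<open>k\<close>-th entry.\<close>
    define p where "p i = (\<Sum>s\<in>T. w s k * w s i)" for i
    have pp: "(\<Sum>i\<in>K. (p i)\<^sup>2) = p k"
    proof -
      have "(\<Sum>i\<in>K. (p i)\<^sup>2) = (\<Sum>i\<in>K. \<Sum>s\<in>T. \<Sum>t\<in>T. (w s k * w t k) * (w s i * w t i))"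
        by (simp add: p_def power2_eq_square sum_product mult_ac)
      also have "\<dots> = (\<Sum>s\<in>T. \<Sum>t\<in>T. (w s k * w t k) * (\<Sum>i\<in>K. w s i * w t i))"
        by (subst sum.swap, rule sum.cong[OF refl], subst sum.swap) (simp add: sum_distrib_left)
      also have "\<dots> = (\<Sum>s\<in>T. \<Sum>t\<in>T. if s = t then w s k * w t k else 0)"
        by (intro sum.cong refl) (simp add: orth)
      also have "\<dots> = p k"
        using assms(2) by (simp add: p_def)
      finally show ?thesis .
    qed
    have "0 \<le> (\<Sum>i\<in>K. ((if i = k then 1 else 0) - p i)\<^sup>2)"
      by (simp add: sum_nonneg)
    also have "\<dots> = (\<Sum>i\<in>K. (if i = k then 1 - 2 * p i else 0) + (p i)\<^sup>2)"
      by (intro sum.cong) (auto simp: power2_diff)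
    also have "\<dots> = 1 - p k"
      using k assms(1) by (simp add: sum.distrib pp)
    finally show ?thesis
      by (simp add: p_def power2_eq_square)
  qed
  have "real (card T) = (\<Sum>s\<in>T. \<Sum>i\<in>K. (w s i)\<^sup>2)"
    using orth by (simp add: power2_eq_square)
  also have "\<dots> = (\<Sum>i\<in>K. \<Sum>s\<in>T. (w s i)\<^sup>2)"
    by (rule sum.swap)
  also have "\<dots> \<le> (\<Sum>i\<in>K. 1)"
    by (intro sum_mono bessel)
  finally show ?thesis by simp
qed

text \<open>\<open>Max\<close> and \<open>Min\<close> in the definition of the condition number are junk on infinite sets.\<close>

lemma finite_nonzero_singular_values:
  assumes "finite N" "finite I"
  shows "finite (nonzero_singular_values N I A)"
proof (rule ccontr)
  let ?S = "nonzero_singular_values N I A"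
  assume "infinite ?S"
  \<comment> \<open>One singular value more than there are columns suffices: the eigenvectors turn
    out orthogonal in a space of dimension \<open>card I\<close>.\<close>
  then obtain T where T: "T \<subseteq> ?S" "finite T" "card T = Suc (card I)"
    using infinite_arbitrarily_large by blast
  have "\<forall>\<sigma>\<in>?S. \<exists>v. v \<in> ell2 I \<and> v \<noteq> (\<lambda>_. 0) \<and>
      (\<forall>i\<in>I. (\<Sum>n\<in>N. A n i * (\<Sum>j\<in>I. A n j * v j)) = \<sigma>\<^sup>2 * v i)"
    by (auto simp: nonzero_singular_values_def)
  then have "\<exists>v. \<forall>\<sigma>\<in>?S. v \<sigma> \<in> ell2 I \<and> v \<sigma> \<noteq> (\<lambda>_. 0) \<and>
      (\<forall>i\<in>I. (\<Sum>n\<in>N. A n i * (\<Sum>j\<in>I. A n j * v \<sigma> j)) = \<sigma>\<^sup>2 * v \<sigma> i)"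
    by (rule bchoice)
  then obtain v where v: "\<And>\<sigma>. \<sigma> \<in> ?S \<Longrightarrow> v \<sigma> \<in> ell2 I" "\<And>\<sigma>. \<sigma> \<in> ?S \<Longrightarrow> v \<sigma> \<noteq> (\<lambda>_. 0)"
    and ev: "\<And>\<sigma> i. \<sigma> \<in> ?S \<Longrightarrow> i \<in> I \<Longrightarrow>
      (\<Sum>n\<in>N. A n i * (\<Sum>j\<in>I. A n j * v \<sigma> j)) = \<sigma>\<^sup>2 * v \<sigma> i"
    by blast
  \<comment> \<open>The right-hand side is the inner product of the images under \<open>A\<close>,
    hence symmetric in \<open>s\<close> and \<open>t\<close>. Swapping them forces orthogonality,
    because distinct positive numbers have distinct squares.\<close>
  have quad: "s\<^sup>2 * (\<Sum>i\<in>I. v s i * v t i) =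
      (\<Sum>n\<in>N. (\<Sum>j\<in>I. A n j * v s j) * (\<Sum>j\<in>I. A n j * v t j))" if "s \<in> ?S" for s t
  proof -
    have "s\<^sup>2 * (\<Sum>i\<in>I. v s i * v t i) = (\<Sum>i\<in>I. (s\<^sup>2 * v s i) * v t i)"
      by (simp add: sum_distrib_left mult.assoc)
    also have "\<dots> = (\<Sum>i\<in>I. (\<Sum>n\<in>N. A n i * (\<Sum>j\<in>I. A n j * v s j)) * v t i)"
      by (intro sum.cong refl) (simp only: ev[OF that])
    also have "\<dots> = (\<Sum>i\<in>I. \<Sum>n\<in>N. (\<Sum>j\<in>I. A n j * v s j) * (A n i * v t i))"
      by (simp add: sum_distrib_right sum_distrib_left mult_ac)
    also have "\<dots> = (\<Sum>n\<in>N. (\<Sum>j\<in>I. A n j * v s j) * (\<Sum>i\<in>I. A n i * v t i))"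
      by (subst sum.swap) (simp add: sum_distrib_left)
    finally show ?thesis .
  qed
  have orth: "(\<Sum>i\<in>I. v s i * v t i) = 0" if "s \<in> ?S" "t \<in> ?S" "s \<noteq> t" for s t
  proof -
    have "s\<^sup>2 * (\<Sum>i\<in>I. v s i * v t i) = t\<^sup>2 * (\<Sum>i\<in>I. v s i * v t i)"
      using quad[OF that(1), of t] quad[OF that(2), of s] by (simp add: mult.commute)
    moreover have "s\<^sup>2 \<noteq> t\<^sup>2"
      using that by (auto simp: nonzero_singular_values_def power2_eq_iff)
    ultimately show ?thesis by simp
  qed
  define w where "w s i = v s i / L2_set (v s) I" for s i
  have "(\<Sum>i\<in>I. w s i * w t i) = (if s = t then 1 else 0)" if "s \<in> T" "t \<in> T" for s t
  proof -
    have S: "s \<in> ?S" "t \<in> ?S" using that T(1) by auto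
    have "(\<Sum>i\<in>I. w s i * w t i) =
        (\<Sum>i\<in>I. v s i * v t i) / (L2_set (v s) I * L2_set (v t) I)"
      by (simp add: w_def sum_divide_distrib)
    moreover have "(\<Sum>i\<in>I. v s i * v s i) = L2_set (v s) I * L2_set (v s) I"
      using L2_set_power2[of "v s" I] by (simp add: power2_eq_square)
    moreover have "0 < L2_set (v s) I"
      using L2_set_pos_if_ell2[OF assms(2)] v S by blast
    ultimately show ?thesis
      using orth[OF S] by auto
  qed
  then have "card T \<le> card I"
    by (rule card_orthonormal_le[OF assms(2) T(2)])
  with T(3) show False by simp
qed

text \<open>\<open>a\<close> stands for the reciprocal of a lower bound; its positivity follows once
  a singular value exists. The \<open>max 1\<close> covers the convention for matrices without
  nonzero singular values.\<close>

lemma condition_number_le: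
  assumes "finite N" "finite I"
    and upper: "\<And>\<sigma>. \<sigma> \<in> nonzero_singular_values N I A \<Longrightarrow> \<sigma> \<le> b"
    and lower: "\<And>\<sigma>. \<sigma> \<in> nonzero_singular_values N I A \<Longrightarrow> 1 \<le> a * \<sigma>"
  shows "condition_number N I A \<le> max 1 (a * b)"
proof (cases "nonzero_singular_values N I A = {}")
  case True
  then show ?thesis by (simp add: condition_number_def)
next
  case False
  let ?S = "nonzero_singular_values N I A"
  have fin: "finite ?S"
    by (rule finite_nonzero_singular_values) fact+
  have max: "Max ?S \<in> ?S" and min: "Min ?S \<in> ?S"
    using fin False by simp_all
  have pos: "0 < Max ?S" "0 < Min ?S"
    using max min by (auto simp: nonzero_singular_values_def)
  have "0 < a * Min ?S" using lower[OF min] by linarith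
  then have a: "0 < a" using pos by (simp add: zero_less_mult_iff)
  have "Max ?S / Min ?S \<le> a * Max ?S"
    using mult_right_mono[OF lower[OF min], of "Max ?S"] pos
    by (simp add: pos_divide_le_eq mult_ac)
  also have "\<dots> \<le> a * b"
    using upper[OF max] a by simp
  finally show ?thesis
    using False by (simp add: condition_number_def Let_def)
qed


section \<open>Functionals on finite-dimensional subspaces\<close>

lemma linear_on_sum:
  assumes f: "linear_on S f" and S: "subspace S" and "\<And>k. k \<in> K \<Longrightarrow> x k \<in> S"
  shows "f (\<Sum>k\<in>K. c k *\<^sub>R x k) = (\<Sum>k\<in>K. c k * f (x k))"
proof -
  have "f (0 *\<^sub>R 0) = 0 * f 0"
    using f subspace_0[OF S] unfolding linear_on_def by blast
  then have 0: "f 0 = 0" by simp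
  show ?thesis
    using assms(3)
  proof (induction K rule: infinite_finite_induct)
    case (insert k K)
    have "c k *\<^sub>R x k \<in> S" "(\<Sum>k\<in>K. c k *\<^sub>R x k) \<in> S"
      using insert.prems S by (auto intro: subspace_scale subspace_sum)
    then show ?case
      using insert f by (simp add: linear_on_def)
  qed (simp_all add: 0)
qed

text \<open>In an orthogonal spanning set, Cauchy-Schwarz bounds the coefficient of \<open>x\<close>
  at \<open>c\<close> by |x| / |c|, which explains the constant \<open>M\<close>.\<close>

lemma linear_on_span_bounded:
  fixes f :: "'x::real_inner \<Rightarrow> real"
  assumes "finite B" "linear_on (span B) f"
  obtains M where "0 \<le> M" "\<And>x. x \<in> span B \<Longrightarrow> \<bar>f x\<bar> \<le> M * norm x"
proof -
  obtain C where C: "finite C" "span C = span B" "pairwise orthogonal C"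
    using basis_orthogonal[OF assms(1)] by blast
  define M where "M = (\<Sum>c\<in>C. \<bar>f c\<bar> / norm c)"
  have "\<bar>f x\<bar> \<le> M * norm x" if "x \<in> span B" for x
  proof -
    from that obtain u where x: "x = (\<Sum>c\<in>C. u c *\<^sub>R c)"
      unfolding C(2)[symmetric] span_finite[OF C(1)] by auto
    have fx: "f x = (\<Sum>c\<in>C. u c * f c)"
      unfolding x using span_base[of _ C, unfolded C(2)]
      by (rule linear_on_sum[OF assms(2) subspace_span])
    have "\<bar>u c * f c\<bar> \<le> \<bar>f c\<bar> / norm c * norm x" if c: "c \<in> C" for c
    proof (cases "c = 0")
      case True
      \<comment> \<open>A zero vector in \<open>C\<close> is harmless: its term in \<open>M\<close>
        is 0 by the convention for division by zero, and so is the value of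
        \<open>f\<close>.\<close>
      have "f 0 = 0"
        using linear_on_sum[OF assms(2) subspace_span, of "{}"] by simp
      with True show ?thesis by simp
    next
      case False
      have "inner x c = (\<Sum>d\<in>C. if d = c then u c * (norm c)\<^sup>2 else 0)"
        unfolding x inner_sum_left using C(3) c
        by (intro sum.cong)
           (auto simp: pairwise_def orthogonal_def power2_norm_eq_inner)
      then have "\<bar>u c\<bar> * (norm c)\<^sup>2 = \<bar>inner x c\<bar>"
        using C(1) c by (simp add: abs_mult)
      also have "\<dots> \<le> norm x * norm c"
        by (rule Cauchy_Schwarz_ineq2)
      finally have "\<bar>u c\<bar> * norm c \<le> norm x"
        using False by (simp add: power2_eq_square mult.assoc[symmetric])
      then have "\<bar>u c\<bar> \<le> norm x / norm c"
        using False by (simp add: pos_le_divide_eq)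
      then show ?thesis
        using mult_left_mono[of "\<bar>u c\<bar>" "norm x / norm c" "\<bar>f c\<bar>"] by (simp add: abs_mult mult_ac)
    qed
    then have "\<bar>f x\<bar> \<le> (\<Sum>c\<in>C. \<bar>f c\<bar> / norm c * norm x)"
      unfolding fx by (intro order_trans[OF sum_abs] sum_mono)
    then show ?thesis by (simp add: M_def sum_distrib_right)
  qed
  moreover have "0 \<le> M" by (simp add: M_def sum_nonneg)
  ultimately show thesis using that by blast
qed

lemma dual_space_span_finite:
  fixes f :: "'x::real_inner \<Rightarrow> real"
  assumes "finite B" "linear_on (span B) f"
  shows "f \<in> dual_space (span B)"
proof -
  obtain M where "\<And>x. x \<in> span B \<Longrightarrow> \<bar>f x\<bar> \<le> M * norm x"
    using linear_on_span_bounded[OF assms] by blast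
  then show ?thesis using assms(2) by (auto simp: dual_space_def)
qed

lemma op_norm_on_le:
  fixes nX :: "'x::zero \<Rightarrow> real"
  assumes "0 \<in> S" "nX 0 \<le> 1" "\<And>x. x \<in> S \<Longrightarrow> nX x \<le> 1 \<Longrightarrow> nZ (f x) \<le> M"
  shows "op_norm_on S nX nZ f \<le> M"
  unfolding op_norm_on_def using assms by (intro cSUP_least) auto

text \<open>A real \<open>SUP\<close> is meaningful only over a bounded set; \<open>M\<close>
  witnesses boundedness and leaves no trace in the conclusion.\<close>

lemma le_op_norm_on:
  assumes "x \<in> S" "nX x \<le> 1" "\<And>x. x \<in> S \<Longrightarrow> nX x \<le> 1 \<Longrightarrow> nZ (f x) \<le> M"
  shows "nZ (f x) \<le> op_norm_on S nX nZ f"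
  unfolding op_norm_on_def using assms by (intro cSUP_upper bdd_aboveI2) auto

lemma op_norm_on_nonneg:
  assumes "x \<in> S" "nX x \<le> 1" "\<And>x. x \<in> S \<Longrightarrow> nX x \<le> 1 \<Longrightarrow> nZ (f x) \<le> M" "\<And>z. 0 \<le> nZ z"
  shows "0 \<le> op_norm_on S nX nZ f"
proof -
  have "0 \<le> nZ (f x)" by (rule assms(4))
  also have "\<dots> \<le> op_norm_on S nX nZ f" using assms(1-3) by (rule le_op_norm_on)
  finally show ?thesis .
qed

text \<open>The constant in \<open>dual_space\<close> may be negative when the subspace is zero,
  hence \<open>max 0 B\<close>.\<close>

lemma bounded_on_unit_ball:
  fixes x :: "'x::real_normed_vector" and r :: real
  assumes "r \<le> B * norm x" "norm x \<le> 1"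
  shows "r \<le> max 0 B"
proof -
  have "B * norm x \<le> max 0 B * norm x" by (intro mult_right_mono) auto
  also have "\<dots> \<le> max 0 B * 1" using assms(2) by (intro mult_left_mono) auto
  finally show ?thesis using assms(1) by simp
qed

text \<open>Normalise \<open>x\<close>. Asking only for homogeneity of \<open>nZ (f x)\<close> lets
  one argument serve functionals (\<open>abs\<close>) and the coefficient map
  (\<open>L2_set\<close>).\<close>

lemma homogeneous_le_op_norm_on:
  fixes S :: "'x::real_normed_vector set"
  assumes S: "subspace S" and x: "x \<in> S"
    and hom: "\<And>c x. x \<in> S \<Longrightarrow> nZ (f (c *\<^sub>R x)) = \<bar>c\<bar> * nZ (f x)"
    and bound: "\<And>x. x \<in> S \<Longrightarrow> nZ (f x) \<le> B * norm x"
  shows "nZ (f x) \<le> op_norm_on S norm nZ f * norm x"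
proof (cases "x = 0")
  case True
  then show ?thesis using bound[OF x] by simp
next
  case False
  have "x /\<^sub>R norm x \<in> S" using S x by (rule subspace_scale)
  then have "nZ (f (x /\<^sub>R norm x)) \<le> op_norm_on S norm nZ f"
    by (intro le_op_norm_on[where M = "max 0 B"] bounded_on_unit_ball[OF bound])
      (auto simp: False)
  then have "nZ (f x) / norm x \<le> op_norm_on S norm nZ f"
    using hom[OF x, of "inverse (norm x)"] by (simp add: divide_inverse mult.commute)
  then show ?thesis
    using False by (simp add: pos_divide_le_eq)
qed

lemma abs_le_dual_norm:
  assumes "subspace S" "f \<in> dual_space S" "x \<in> S"
  shows "\<bar>f x\<bar> \<le> dual_norm S f * norm x"
proof -
  from assms(2) obtain B where "linear_on S f" "\<And>x. x \<in> S \<Longrightarrow> \<bar>f x\<bar> \<le> B * norm x"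
    by (auto simp: dual_space_def)
  then show ?thesis
    unfolding dual_norm_def using assms(1,3)
    by (intro homogeneous_le_op_norm_on[where B = B]) (auto simp: linear_on_def abs_mult)
qed

lemma dual_norm_nonneg:
  assumes "subspace S" "f \<in> dual_space S"
  shows "0 \<le> dual_norm S f"
proof -
  from assms(2) obtain B where "\<And>x. x \<in> S \<Longrightarrow> \<bar>f x\<bar> \<le> B * norm x"
    by (auto simp: dual_space_def)
  then show ?thesis
    unfolding dual_norm_def using subspace_0[OF assms(1)]
    by (intro op_norm_on_nonneg[where x = 0 and M = "max 0 B"] bounded_on_unit_ball) auto
qed

lemma dual_norm_le:
  assumes "subspace S" "0 \<le> M" "\<And>x. x \<in> S \<Longrightarrow> \<bar>f x\<bar> \<le> M * norm x"
  shows "dual_norm S f \<le> M"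
  unfolding dual_norm_def
proof (rule op_norm_on_le)
  fix x assume "x \<in> S" "norm x \<le> 1"
  then show "\<bar>f x\<bar> \<le> M"
    using assms(3)[of x] mult_left_mono[of "norm x" 1 M] assms(2) by simp
qed (use subspace_0[OF assms(1)] in auto)


section \<open>Finite frames\<close>

lemma frame_element_mem: "frame_for S K \<psi> c C \<Longrightarrow> i \<in> K \<Longrightarrow> \<psi> i \<in> S"
  using closure_subset[of "span (\<psi> ` K)"] span_superset[of "\<psi> ` K"]
  by (fastforce simp: frame_for_def)

lemma frame_constants_pos:
  assumes "frame_for S K \<psi> c C"
  shows "0 < c" "0 < C"
  using assms by (simp_all add: frame_for_def)

lemma frame_functional_bounds:
  assumes "frame_for S K \<psi> c C" "finite K" "subspace S" "f \<in> dual_space S"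
  shows "c * dual_norm S f \<le> L2_set (\<lambda>i. f (\<psi> i)) K"
    and "L2_set (\<lambda>i. f (\<psi> i)) K \<le> C * dual_norm S f"
proof -
  have "c\<^sup>2 * (dual_norm S f)\<^sup>2 \<le> (\<Sum>i\<in>K. (f (\<psi> i))\<^sup>2)"
    "(\<Sum>i\<in>K. (f (\<psi> i))\<^sup>2) \<le> C\<^sup>2 * (dual_norm S f)\<^sup>2" and pos: "0 < c" "0 < C"
    using assms by (auto simp: frame_for_def)
  then have "(c * dual_norm S f)\<^sup>2 \<le> (L2_set (\<lambda>i. f (\<psi> i)) K)\<^sup>2"
    "(L2_set (\<lambda>i. f (\<psi> i)) K)\<^sup>2 \<le> (C * dual_norm S f)\<^sup>2"
    by (simp_all add: L2_set_power2 power_mult_distrib)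
  then show "c * dual_norm S f \<le> L2_set (\<lambda>i. f (\<psi> i)) K"
    "L2_set (\<lambda>i. f (\<psi> i)) K \<le> C * dual_norm S f"
    using pos dual_norm_nonneg[OF assms(3,4)]
    by (auto intro: power2_le_imp_le simp: L2_set_nonneg)
qed

lemma synthesis_mem:
  assumes "frame_for S K \<psi> c C" "subspace S"
  shows "synthesis K \<psi> v \<in> S"
  unfolding synthesis_def using assms
  by (intro subspace_sum subspace_scale) (auto intro: frame_element_mem)

lemma linear_on_synthesis:
  assumes "frame_for S K \<psi> c C" "subspace S" "linear_on S f"
  shows "f (synthesis K \<psi> v) = (\<Sum>i\<in>K. v i * f (\<psi> i))"
  unfolding synthesis_def using assms by (intro linear_on_sum) (auto intro: frame_element_mem)

text \<open>Duality: the synthesised vector \<open>s\<close> is tested with the functional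
  \<open>inner s\<close>, of dual norm at most |s|. The upper frame bound then gives |s|^2 <= |v| C
  |s|.\<close>

lemma norm_synthesis_le:
  fixes \<psi> :: "'k \<Rightarrow> 'x::real_inner"
  assumes "frame_for S K \<psi> c C" "finite K" "subspace S"
  shows "norm (synthesis K \<psi> v) \<le> C * L2_set v K"
proof -
  define s where "s = synthesis K \<psi> v"
  have dual: "inner s \<in> dual_space S"
    unfolding dual_space_def linear_on_def
    using Cauchy_Schwarz_ineq2[of s] by (auto simp: inner_add_right)
  have "L2_set (\<lambda>i. inner s (\<psi> i)) K \<le> C * dual_norm S (inner s)"
    by (rule frame_functional_bounds) (fact assms dual)+
  also have "\<dots> \<le> C * norm s"
    using frame_constants_pos[OF assms(1)] assms(3)
    by (intro mult_left_mono dual_norm_le Cauchy_Schwarz_ineq2) auto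
  finally have *: "L2_set (\<lambda>i. inner s (\<psi> i)) K \<le> C * norm s" .
  have "(norm s)\<^sup>2 = (\<Sum>i\<in>K. v i * inner s (\<psi> i))"
    using linear_on_synthesis[OF assms(1,3), of "inner s" v] dual
    by (simp add: power2_norm_eq_inner s_def dual_space_def)
  also have "\<dots> \<le> L2_set v K * L2_set (\<lambda>i. inner s (\<psi> i)) K"
    by (rule sum_mult_le_L2_set)
  also have "\<dots> \<le> L2_set v K * (C * norm s)"
    using * by (intro mult_left_mono L2_set_nonneg)
  finally have le: "norm s * norm s \<le> (C * L2_set v K) * norm s"
    by (simp add: power2_eq_square mult_ac)
  show ?thesis
  proof (cases "s = 0")
    case True
    then show ?thesis
      using frame_constants_pos[OF assms(1)] by (simp add: s_def[symmetric] L2_set_nonneg)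
  next
    case False
    then show ?thesis using le by (simp add: s_def[symmetric])
  qed
qed

text \<open>
  Coefficient vectors of the form \<open>(f (\<psi> i))\<^sub>i\<close> make up the orthogonal complement of the kernel
  of the synthesis map, so this is the lower bound for the synthesis map modulo its kernel.
\<close>

lemma norm_synthesis_ge:
  assumes "frame_for S K \<psi> c C" "finite K" "subspace S" "f \<in> dual_space S"
    and v: "\<And>i. i \<in> K \<Longrightarrow> v i = f (\<psi> i)"
  shows "c * L2_set v K \<le> norm (synthesis K \<psi> v)"
proof -
  let ?s = "synthesis K \<psi> v"
  have c: "0 < c" using frame_constants_pos[OF assms(1)] by simp
  have vf: "L2_set (\<lambda>i. f (\<psi> i)) K = L2_set v K"
    using v by (intro L2_set_cong) auto
  \<comment> \<open>Evaluating \<open>f\<close> at the synthesis of its own values returns |v|^2,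
    while the lower frame bound limits the dual norm of \<open>f\<close> to |v| / c.\<close>
  have "(L2_set v K)\<^sup>2 = (\<Sum>i\<in>K. v i * f (\<psi> i))"
    unfolding L2_set_power2 using v by (intro sum.cong) (simp_all add: power2_eq_square)
  also have "\<dots> = f ?s"
    using linear_on_synthesis[OF assms(1,3), of f v] assms(4) by (simp add: dual_space_def)
  also have "\<dots> \<le> dual_norm S f * norm ?s"
    using abs_le_dual_norm[OF assms(3,4) synthesis_mem[OF assms(1,3)], of v] by linarith
  finally have "c * (L2_set v K)\<^sup>2 \<le> c * dual_norm S f * norm ?s"
    using c by simp
  also have "\<dots> \<le> L2_set v K * norm ?s"
    using frame_functional_bounds(1)[OF assms(1-4)] unfolding vf by (intro mult_right_mono) auto
  finally have le: "L2_set v K * (c * L2_set v K) \<le> L2_set v K * norm ?s"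
    by (simp add: power2_eq_square mult_ac)
  show ?thesis
  proof (cases "L2_set v K = 0")
    case False
    then have "0 < L2_set v K" using L2_set_nonneg[of v K] by linarith
    then show ?thesis using le by simp
  qed simp
qed


section \<open>The two condition numbers\<close>

lemma synthesis_unit:
  assumes "finite K" "i \<in> K"
  shows "synthesis K \<psi> (\<lambda>k. if k = i then 1 else 0) = \<psi> i"
proof -
  have "synthesis K \<psi> (\<lambda>k. if k = i then 1 else 0) = (\<Sum>k\<in>K. if k = i then \<psi> k else 0)"
    unfolding synthesis_def by (intro sum.cong) auto
  then show ?thesis using assms by simp
qed

text \<open>With \<open>s\<close> the synthesis of \<open>v\<close>, one has \<sigma> |v| = |G (T
  s)|. Going down, this is at most g a C |v|; going back, c |v| <= |s| <= b g' |G (T s)|.\<close>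

lemma condition_number_matrix_of_le:
  fixes T :: "'u::real_inner \<Rightarrow> 'x::real_inner" and G :: "'x \<Rightarrow> 'n \<Rightarrow> real"
  assumes frame: "frame_for (span (\<phi> ` I)) I \<phi> c C" and fin: "finite I" "finite N"
    and T: "linear T"
    and T_upper: "\<And>u. norm (T u) \<le> a * norm u" and T_lower: "\<And>u. norm u \<le> b * norm (T u)"
    and G_linear: "\<And>n. linear_on (T ` span (\<phi> ` I)) (\<lambda>h. G h n)"
    and G_upper: "\<And>h. h \<in> T ` span (\<phi> ` I) \<Longrightarrow> L2_set (G h) N \<le> g * norm h"
    and G_lower: "\<And>h. h \<in> T ` span (\<phi> ` I) \<Longrightarrow> norm h \<le> g' * L2_set (G h) N"
    and nonneg: "0 \<le> a" "0 \<le> b" "0 \<le> g" "0 \<le> g'"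
  shows "condition_number N I (matrix_of (G \<circ> T \<circ> synthesis I \<phi>)) \<le> max 1 (a * b * (g * g') * (C / c))"
proof -
  let ?S = "span (\<phi> ` I)" and ?A = "matrix_of (G \<circ> T \<circ> synthesis I \<phi>)"
  have c: "0 < c" "0 < C" using frame_constants_pos[OF frame] by auto
  have A: "?A n i = G (T (\<phi> i)) n" if "i \<in> I" for n i
    using that fin by (simp add: matrix_of_def synthesis_unit)
  have GT: "linear_on ?S (\<lambda>s. G (T s) n)" for n
    using G_linear[of n] by (auto simp: linear_on_def linear_add[OF T] linear_scale[OF T])
  have bounds: "\<sigma> \<le> g * (a * C) \<and> 1 \<le> (b * g' / c) * \<sigma>" if \<sigma>: "\<sigma> \<in> nonzero_singular_values N I ?A" for \<sigma>
  proof -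
    obtain v z where pos: "0 < \<sigma>" "0 < L2_set v I" and z: "\<And>n. z n = (\<Sum>j\<in>I. ?A n j * v j)"
      and v: "\<And>i. i \<in> I \<Longrightarrow> v i = (\<Sum>n\<in>N. ?A n i * z n) / \<sigma>\<^sup>2"
      and zv: "L2_set z N = \<sigma> * L2_set v I"
      using nonzero_singular_valueE[OF \<sigma> fin(2,1)] by blast
    define s where "s = synthesis I \<phi> v"
    have s: "s \<in> ?S" unfolding s_def by (rule synthesis_mem[OF frame subspace_span])
    then have Ts: "T s \<in> T ` ?S" by (rule imageI)
    have "z n = G (T s) n" for n
      unfolding z s_def linear_on_synthesis[OF frame subspace_span GT]
      by (intro sum.cong) (simp_all add: A)
    then have Gs: "L2_set (G (T s)) N = \<sigma> * L2_set v I"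
      unfolding zv[symmetric] by (intro L2_set_cong) auto
    have "\<sigma> * L2_set v I \<le> g * norm (T s)"
      unfolding Gs[symmetric] by (rule G_upper[OF Ts])
    also have "\<dots> \<le> g * (a * (C * L2_set v I))"
      using nonneg norm_synthesis_le[OF frame fin(1) subspace_span, of v]
      by (intro mult_left_mono order_trans[OF T_upper]) (auto simp: s_def)
    finally have upper: "\<sigma> \<le> g * (a * C)"
      using pos by (simp add: mult.assoc[symmetric])
    \<comment> \<open>The value of this functional at \<phi> i is \<open>v i\<close>. It is bounded
      because the span is finite dimensional; its dual norm does not enter the estimate.\<close>
    have "linear_on ?S (\<lambda>s. (\<Sum>n\<in>N. G (T s) n * z n) / \<sigma>\<^sup>2)"
      using GT by (simp add: linear_on_def distrib_right sum.distrib add_divide_distrib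
          mult.assoc sum_distrib_left[symmetric])
    then have "(\<lambda>s. (\<Sum>n\<in>N. G (T s) n * z n) / \<sigma>\<^sup>2) \<in> dual_space ?S"
      using fin by (intro dual_space_span_finite) auto
    then have "c * L2_set v I \<le> norm s"
      unfolding s_def using v A by (intro norm_synthesis_ge[OF frame fin(1) subspace_span]) auto
    also have "\<dots> \<le> b * (g' * L2_set (G (T s)) N)"
      by (rule order_trans[OF T_lower]) (intro mult_left_mono G_lower Ts nonneg)
    finally have "c * L2_set v I \<le> (b * g' * \<sigma>) * L2_set v I"
      by (simp add: Gs mult_ac)
    then have "c \<le> b * g' * \<sigma>"
      using pos by simp
    then show ?thesis
      using upper c by (simp add: pos_le_divide_eq)
  qed
  have "condition_number N I ?A \<le> max 1 ((b * g' / c) * (g * (a * C)))"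
    using bounds by (intro condition_number_le fin) auto
  then show ?thesis by (simp add: mult_ac)
qed

text \<open>The form may be nonsymmetric, so the matrix and its transpose use different slots:
  \<open>z\<close> consists of values of b(., h), and \<open>v\<close> of values of b(g, .) /
  \<sigma>^2.\<close>

lemma condition_number_gram_matrix_le:
  fixes \<psi> :: "'n \<Rightarrow> 'x::real_inner"
  assumes frame: "frame_for S K \<psi> c C" and fin: "finite K" and S: "subspace S"
    and bilinear: "bilinear_on S b"
    and bounded: "\<And>g h. g \<in> S \<Longrightarrow> h \<in> S \<Longrightarrow> \<bar>b g h\<bar> \<le> M * norm g * norm h"
    and coercive: "\<And>h. h \<in> S \<Longrightarrow> m * (norm h)\<^sup>2 \<le> b h h"
    and const: "0 \<le> M" "0 < m"
  shows "condition_number K K (gram_matrix b \<psi>) \<le> max 1 (M / m * (C / c)\<^sup>2)"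
proof -
  let ?A = "gram_matrix b \<psi>"
  have c: "0 < c" "0 < C" using frame_constants_pos[OF frame] by auto
  have lin: "linear_on S (b h)" "linear_on S (\<lambda>g. b g h)" if "h \<in> S" for h
    using bilinear that by (auto simp: bilinear_on_def)
  have bounds: "\<sigma> \<le> M * C\<^sup>2 \<and> 1 \<le> (1 / (m * c\<^sup>2)) * \<sigma>"
    if \<sigma>: "\<sigma> \<in> nonzero_singular_values K K ?A" for \<sigma>
  proof -
    obtain v z where pos: "0 < \<sigma>" "0 < L2_set v K" and z: "\<And>n. z n = (\<Sum>j\<in>K. ?A n j * v j)"
      and v: "\<And>i. i \<in> K \<Longrightarrow> v i = (\<Sum>n\<in>K. ?A n i * z n) / \<sigma>\<^sup>2"
      and zv: "L2_set z K = \<sigma> * L2_set v K"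
      using nonzero_singular_valueE[OF \<sigma> fin fin] by blast
    define h where "h = synthesis K \<psi> v"
    define g where "g = synthesis K \<psi> z"
    have hS: "h \<in> S" and gS: "g \<in> S"
      unfolding h_def g_def by (rule synthesis_mem[OF frame S])+
    have \<psi>S: "\<psi> n \<in> S" if "n \<in> K" for n
      using frame_element_mem[OF frame that] .
    have zb: "z n = b (\<psi> n) h" if "n \<in> K" for n
      unfolding z h_def linear_on_synthesis[OF frame S lin(1)[OF \<psi>S[OF that]]]
      by (simp add: gram_matrix_def mult.commute)
    have vb: "v n = b g (\<psi> n) / \<sigma>\<^sup>2" if "n \<in> K" for n
      unfolding v[OF that] g_def linear_on_synthesis[OF frame S lin(2)[OF \<psi>S[OF that]]]
      by (simp add: gram_matrix_def mult.commute)
    have bh: "(\<lambda>x. b x h) \<in> dual_space S"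
      using lin(2)[OF hS] bounded[OF _ hS]
      by (auto simp: dual_space_def mult_ac intro!: exI[of _ "M * norm h"])
    \<comment> \<open>The upper frame bound enters twice, for the values of a functional and for the
      synthesis of \<open>v\<close>; hence the square of \<open>C\<close>.\<close>
    have "\<sigma> * L2_set v K = L2_set (\<lambda>n. b (\<psi> n) h) K"
      unfolding zv[symmetric] using zb by (intro L2_set_cong) auto
    also have "\<dots> \<le> C * dual_norm S (\<lambda>x. b x h)"
      by (rule frame_functional_bounds(2)[OF frame fin S bh])
    also have "\<dots> \<le> C * (M * norm h)"
      using bounded[OF _ hS] c const S by (intro mult_left_mono dual_norm_le) (auto simp: mult_ac)
    also have "\<dots> \<le> C * (M * (C * L2_set v K))"
      unfolding h_def using c const by (intro mult_left_mono norm_synthesis_le[OF frame fin S]) auto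
    finally have "\<sigma> * L2_set v K \<le> (M * C\<^sup>2) * L2_set v K"
      by (simp add: power2_eq_square mult_ac)
    then have upper: "\<sigma> \<le> M * C\<^sup>2" using pos by simp
    \<comment> \<open>Although the bound of this functional involves \<open>g\<close> and \<sigma>,
      only membership in the dual space is passed to \<open>norm_synthesis_ge\<close>.\<close>
    have "linear_on S (\<lambda>x. b g x / \<sigma>\<^sup>2)"
      using lin(1)[OF gS] by (simp add: linear_on_def add_divide_distrib)
    moreover have "\<bar>b g x / \<sigma>\<^sup>2\<bar> \<le> M * norm g / \<sigma>\<^sup>2 * norm x" if "x \<in> S" for x
      using bounded[OF gS that] by (simp add: divide_right_mono)
    ultimately have "(\<lambda>x. b g x / \<sigma>\<^sup>2) \<in> dual_space S"
      unfolding dual_space_def by blast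
    then have "c * L2_set v K \<le> norm h"
      unfolding h_def using vb by (intro norm_synthesis_ge[OF frame fin S]) auto
    then have "(c * L2_set v K)\<^sup>2 \<le> (norm h)\<^sup>2"
      using c by (intro power_mono) (auto simp: L2_set_nonneg)
    then have "m * (c * L2_set v K)\<^sup>2 \<le> m * (norm h)\<^sup>2"
      using const by simp
    also have "\<dots> \<le> b h h"
      by (rule coercive[OF hS])
    \<comment> \<open>Expanding only the first argument turns coercivity into a pairing of
      \<open>v\<close> with \<open>z\<close> = A v, which is at most \<sigma> |v|^2.\<close>
    also have "b h h = (\<Sum>n\<in>K. v n * b (\<psi> n) h)"
      by (subst (1) h_def, rule linear_on_synthesis[OF frame S lin(2)[OF hS]])
    also have "\<dots> = (\<Sum>n\<in>K. v n * z n)"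
      using zb by simp
    also have "\<dots> \<le> L2_set v K * L2_set z K"
      by (rule sum_mult_le_L2_set)
    finally have "(m * c\<^sup>2) * (L2_set v K)\<^sup>2 \<le> \<sigma> * (L2_set v K)\<^sup>2"
      unfolding zv by (simp add: power2_eq_square mult_ac)
    then have "m * c\<^sup>2 \<le> \<sigma>" using pos by simp
    then show ?thesis using upper const c by simp
  qed
  have "condition_number K K ?A \<le> max 1 ((1 / (m * c\<^sup>2)) * (M * C\<^sup>2))"
    using bounds by (intro condition_number_le fin) auto
  then show ?thesis by (simp add: power_divide mult_ac)
qed

text \<open>The suprema \<open>g\<close> and \<open>g'\<close> must be shown finite before they act
  as bounds. For \<open>G\<close> this is finite dimensionality; for its inverse, reproduction with
  the upper frame bound gives |h| <= C |G h|.\<close>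

lemma coefficient_map_bounds:
  fixes H :: "'x::real_inner set" and G :: "'x \<Rightarrow> 'n \<Rightarrow> real"
  assumes B: "finite B" "H = span B" and N: "finite N"
    and frame: "frame_for H N \<psi> c C"
    and G_linear: "\<And>n. linear_on H (\<lambda>h. G h n)" and G_inj: "inj_on G H"
    and repr: "\<And>h. h \<in> H \<Longrightarrow> h = synthesis N \<psi> (G h)"
  defines "g \<equiv> op_norm_on H norm (\<lambda>w. L2_set w N) G"
    and "g' \<equiv> op_norm_on (G ` H) (\<lambda>w. L2_set w N) norm (inv_into H G)"
  shows "0 \<le> g" "0 \<le> g'"
    "\<And>h. h \<in> H \<Longrightarrow> L2_set (G h) N \<le> g * norm h"
    "\<And>h. h \<in> H \<Longrightarrow> norm h \<le> g' * L2_set (G h) N"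
proof -
  have S: "subspace H" using B by simp
  have scale: "L2_set (G (r *\<^sub>R x)) N = \<bar>r\<bar> * L2_set (G x) N" if "x \<in> H" for r x
  proof -
    have "L2_set (G (r *\<^sub>R x)) N = L2_set (\<lambda>n. \<bar>r\<bar> * G x n) N"
      using G_linear that by (simp add: L2_set_def linear_on_def power_mult_distrib)
    then show ?thesis by (simp add: L2_set_right_distrib)
  qed
  have G0: "L2_set (G 0) N = 0"
    using scale[OF subspace_0[OF S], of 0] by simp
  have "\<exists>M. \<forall>x\<in>H. \<bar>G x n\<bar> \<le> M * norm x" for n
    using linear_on_span_bounded[OF B(1) G_linear[of n, unfolded B(2)]] unfolding B(2) by metis
  then obtain M where M: "\<And>n x. x \<in> H \<Longrightarrow> \<bar>G x n\<bar> \<le> M n * norm x" by metis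
  have upper: "L2_set (G x) N \<le> (\<Sum>n\<in>N. M n) * norm x" if "x \<in> H" for x
  proof -
    have "(\<Sum>n\<in>N. \<bar>G x n\<bar>) \<le> (\<Sum>n\<in>N. M n) * norm x"
      unfolding sum_distrib_right by (intro sum_mono M that)
    then show ?thesis
      by (rule order_trans[OF L2_set_le_sum_abs])
  qed
  show "0 \<le> g"
    unfolding g_def
    by (rule op_norm_on_nonneg[where x = 0 and M = "max 0 (\<Sum>n\<in>N. M n)"])
      (auto intro: subspace_0[OF S] bounded_on_unit_ball upper)
  show "L2_set (G h) N \<le> g * norm h" if "h \<in> H" for h
    unfolding g_def by (rule homogeneous_le_op_norm_on[OF S that]) (fact scale upper)+
  have C: "norm x \<le> C * L2_set (G x) N" if "x \<in> H" for x
    using norm_synthesis_le[OF frame N S, of "G x"] repr[OF that] by simp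
  have inv: "norm (inv_into H G w) \<le> C" if w: "w \<in> G ` H" "L2_set w N \<le> 1" for w
  proof -
    from w obtain x where x: "x \<in> H" "w = G x" by auto
    then have "norm (inv_into H G w) \<le> C * L2_set w N"
      using C[OF x(1)] G_inj by simp
    also have "\<dots> \<le> C * 1"
      using w(2) frame_constants_pos[OF frame] by (intro mult_left_mono) auto
    finally show ?thesis by simp
  qed
  show "0 \<le> g'"
    unfolding g'_def using subspace_0[OF S]
    by (intro op_norm_on_nonneg[where x = "G 0" and M = C] inv) (simp_all add: G0)
  show "norm h \<le> g' * L2_set (G h) N" if h: "h \<in> H" for h
  proof (cases "L2_set (G h) N = 0")
    \<comment> \<open>Normalising by |G h| is impossible here, but the bound with \<open>C\<close>
      already forces h = 0.\<close>
    case True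
    then show ?thesis using C[OF h] by simp
  next
    case False
    let ?r = "L2_set (G h) N"
    have r: "0 < ?r" using False L2_set_nonneg[of "G h" N] by linarith
    have h': "h /\<^sub>R ?r \<in> H" using S h by (rule subspace_scale)
    have "norm (inv_into H G (G (h /\<^sub>R ?r))) \<le> g'"
      unfolding g'_def using h' scale[OF h, of "inverse ?r"] r
      by (intro le_op_norm_on[where M = C] inv) auto
    then have "norm h / ?r \<le> g'"
      using G_inj h' r by (simp add: divide_inverse mult.commute)
    then show ?thesis using r by (simp add: pos_divide_le_eq)
  qed
qed

lemma range_synthesis_ell2:
  assumes "finite K"
  shows "synthesis K \<psi> ` ell2 K = span (\<psi> ` K)"
proof
  show "synthesis K \<psi> ` ell2 K \<subseteq> span (\<psi> ` K)"
    by (auto simp: synthesis_def intro!: span_sum span_scale intro: span_base)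
  show "span (\<psi> ` K) \<subseteq> synthesis K \<psi> ` ell2 K"
  proof
    fix x assume "x \<in> span (\<psi> ` K)"
    then show "x \<in> synthesis K \<psi> ` ell2 K"
    proof (induction rule: span_induct_alt)
      case base
      show ?case
        by (rule image_eqI[of _ _ "\<lambda>_. 0"]) (auto simp: synthesis_def ell2_def)
    next
      case (step r b y)
      then obtain v i where v: "v \<in> ell2 K" "y = synthesis K \<psi> v" and i: "i \<in> K" "b = \<psi> i"
        by auto
      have "synthesis K \<psi> (\<lambda>k. r * (if k = i then 1 else 0) + v k) =
          r *\<^sub>R synthesis K \<psi> (\<lambda>k. if k = i then 1 else 0) + synthesis K \<psi> v"
        unfolding synthesis_def by (simp add: scaleR_add_left sum.distrib scaleR_sum_right)
      then have "r *\<^sub>R b + y = synthesis K \<psi> (\<lambda>k. r * (if k = i then 1 else 0) + v k)"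
        using v i assms by (simp add: synthesis_unit)
      moreover have "(\<lambda>k. r * (if k = i then 1 else 0) + v k) \<in> ell2 K"
        using v(1) i(1) by (auto simp: ell2_def)
      ultimately show ?case by blast
    qed
  qed
qed

text \<open>The diagonal estimate \<open>form_equiv\<close> leaves the antisymmetric part of the
  form free, so \<open>form_bounded\<close> controls pairs uniformly in \<open>y\<close>; for
  symmetric forms \<open>symmetric_form_bounded\<close> derives it with constant
  \<open>C\<^sub>U\<close>. \<open>chi_uniform\<close> bounds the frame ratio that enters the
  estimate for the Gram matrices.\<close>

theorem corollary5:
  fixes \<Omega> :: "(real^'d::finite) set"
    and Y :: "'y set"
    and \<D> :: "'u::{real_inner, complete_space} \<Rightarrow> ((real^'d) L2)^'m::finite"
    and form :: "'y \<Rightarrow> ((real^'d) L2)^'m \<Rightarrow> ((real^'d) L2)^'m \<Rightarrow> real"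
    and c\<^sub>U C\<^sub>U :: real
    and I :: "nat \<Rightarrow> 'i set" and \<phi> :: "nat \<Rightarrow> 'i \<Rightarrow> 'u" and c\<^sub>\<Phi> C\<^sub>\<Phi> :: "nat \<Rightarrow> real"
    and H\<^sub>\<Phi> :: "nat \<Rightarrow> (((real^'d) L2)^'m) set"
    and N :: "nat \<Rightarrow> 'n set" and chi :: "nat \<Rightarrow> 'n \<Rightarrow> ((real^'d) L2)^'m"
    and c\<^sub>\<chi> C\<^sub>\<chi> :: "nat \<Rightarrow> real"
    and G :: "nat \<Rightarrow> ((real^'d) L2)^'m \<Rightarrow> 'n \<Rightarrow> real"
  assumes domain: "open \<Omega>" "connected \<Omega>" "\<Omega> \<noteq> {}"
    and D_iso: "isomorphism_onto_range \<D>" "range \<D> \<subseteq> L2_space \<Omega>"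
    and form_bilinear: "\<And>y. y \<in> Y \<Longrightarrow> bilinear_on (L2_space \<Omega>) (form y)"
    and constants: "0 < c\<^sub>U" "c\<^sub>U \<le> C\<^sub>U"
    and form_equiv: "\<And>y u. y \<in> Y \<Longrightarrow>
          c\<^sub>U * (norm u)\<^sup>2 \<le> form y (\<D> u) (\<D> u) \<and> form y (\<D> u) (\<D> u) \<le> C\<^sub>U * (norm u)\<^sup>2"
    and form_bounded: "\<exists>M. \<forall>y\<in>Y. \<forall>u v. \<bar>form y (\<D> u) (\<D> v)\<bar> \<le> M * norm u * norm v"
    and I_finite: "\<And>J. finite (I J)"
    and \<Phi>_frame: "\<And>J. frame_for (span (\<phi> J ` I J)) (I J) (\<phi> J) (c\<^sub>\<Phi> J) (C\<^sub>\<Phi> J)"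
    and \<Phi>_uniform: "bdd_above (range (\<lambda>J. C\<^sub>\<Phi> J / c\<^sub>\<Phi> J))"
    and H\<^sub>\<Phi>: "\<And>J. H\<^sub>\<Phi> J = (\<D> \<circ> synthesis (I J) (\<phi> J)) ` ell2 (I J)"
    and N_finite: "\<And>J. finite (N J)"
    and chi_frame: "\<And>J. frame_for (H\<^sub>\<Phi> J) (N J) (chi J) (c\<^sub>\<chi> J) (C\<^sub>\<chi> J)"
    and chi_uniform: "bdd_above (range (\<lambda>J. C\<^sub>\<chi> J / c\<^sub>\<chi> J))"
    and G_range: "\<And>J h. h \<in> H\<^sub>\<Phi> J \<Longrightarrow> G J h \<in> ell2 (N J)"
    and G_linear: "\<And>J n. linear_on (H\<^sub>\<Phi> J) (\<lambda>h. G J h n)"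
    and G_inj: "\<And>J. inj_on (G J) (H\<^sub>\<Phi> J)"
    and G_well_conditioned: "bdd_above (range (\<lambda>J.
          op_norm_on (H\<^sub>\<Phi> J) norm (\<lambda>w. L2_set w (N J)) (G J) *
          op_norm_on (G J ` H\<^sub>\<Phi> J) (\<lambda>w. L2_set w (N J)) norm (inv_into (H\<^sub>\<Phi> J) (G J))))"
    and G_reproduces: "\<And>J h. h \<in> H\<^sub>\<Phi> J \<Longrightarrow> h = (\<Sum>n\<in>N J. G J h n *\<^sub>R chi J n)"
  shows "(\<exists>K. \<forall>J. condition_number (N J) (I J)
                    (matrix_of (G J \<circ> \<D> \<circ> synthesis (I J) (\<phi> J))) \<le> K) \<and>
         (\<exists>K. \<forall>J. \<forall>y\<in>Y. condition_number (N J) (N J) (gram_matrix (form y) (chi J)) \<le> K)"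
proof -
  have bl: "bounded_linear \<D>" and inj: "inj \<D>"
    using D_iso(1) by (auto simp: isomorphism_onto_range_def)
  then have lin: "linear \<D>" by (simp add: bounded_linear.linear)
  obtain a where a: "0 < a" "\<And>u. norm (\<D> u) \<le> a * norm u"
    using bounded_linear.pos_bounded[OF bl] by (metis mult.commute)
  obtain b0 where b0: "\<And>x. x \<in> range \<D> \<Longrightarrow> norm (inv \<D> x) \<le> b0 * norm x"
    using D_iso(1) by (auto simp: isomorphism_onto_range_def)
  \<comment> \<open>The constant in \<open>isomorphism_onto_range\<close> has no sign condition; it
    could be negative if the space is zero.\<close>
  define b where "b = max 0 b0"
  have b: "0 \<le> b" "norm u \<le> b * norm (\<D> u)" for u
  proof -
    have "norm u \<le> b0 * norm (\<D> u)" using b0[of "\<D> u"] inj by simp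
    also have "\<dots> \<le> b * norm (\<D> u)" unfolding b_def by (intro mult_right_mono) auto
    finally show "norm u \<le> b * norm (\<D> u)" .
  qed (simp add: b_def)
  have H_eq: "H\<^sub>\<Phi> J = \<D> ` span (\<phi> J ` I J)" for J
    unfolding H\<^sub>\<Phi> image_comp[symmetric] by (simp add: range_synthesis_ell2[OF I_finite])
  then have H_span: "H\<^sub>\<Phi> J = span (\<D> ` \<phi> J ` I J)" for J
    by (simp add: linear_span_image[OF lin])
  have H_fin: "finite (\<D> ` \<phi> J ` I J)" for J by (simp add: I_finite)
  have H_sub: "subspace (H\<^sub>\<Phi> J)" for J by (simp add: H_span)
  define g where "g J = op_norm_on (H\<^sub>\<Phi> J) norm (\<lambda>w. L2_set w (N J)) (G J)" for J
  define g' where "g' J = op_norm_on (G J ` H\<^sub>\<Phi> J) (\<lambda>w. L2_set w (N J)) norm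
    (inv_into (H\<^sub>\<Phi> J) (G J))" for J
  have repr: "h = synthesis (N J) (chi J) (G J h)" if "h \<in> H\<^sub>\<Phi> J" for J h
    using G_reproduces[OF that] by (simp add: synthesis_def)
  note G_bounds = coefficient_map_bounds[OF H_fin H_span N_finite chi_frame G_linear G_inj repr,
      folded g_def g'_def]
  obtain K\<^sub>G where K\<^sub>G: "\<And>J. g J * g' J \<le> K\<^sub>G"
    using G_well_conditioned unfolding g_def g'_def bdd_above_def by auto
  obtain K\<^sub>\<Phi> where K\<^sub>\<Phi>: "\<And>J. C\<^sub>\<Phi> J / c\<^sub>\<Phi> J \<le> K\<^sub>\<Phi>"
    using \<Phi>_uniform unfolding bdd_above_def by auto
  obtain K\<^sub>\<chi> where K\<^sub>\<chi>: "\<And>J. C\<^sub>\<chi> J / c\<^sub>\<chi> J \<le> K\<^sub>\<chi>"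
    using chi_uniform unfolding bdd_above_def by auto
  have "condition_number (N J) (I J) (matrix_of (G J \<circ> \<D> \<circ> synthesis (I J) (\<phi> J)))
      \<le> max 1 (a * b * K\<^sub>G * K\<^sub>\<Phi>)" for J
  proof -
    have "condition_number (N J) (I J) (matrix_of (G J \<circ> \<D> \<circ> synthesis (I J) (\<phi> J)))
        \<le> max 1 (a * b * (g J * g' J) * (C\<^sub>\<Phi> J / c\<^sub>\<Phi> J))"
      using a b G_linear G_bounds unfolding H_eq
      by (intro condition_number_matrix_of_le[OF \<Phi>_frame I_finite N_finite lin]) auto
    also have "\<dots> \<le> max 1 (a * b * K\<^sub>G * K\<^sub>\<Phi>)"
    proof (intro max.mono order_refl mult_mono)
      show "0 \<le> C\<^sub>\<Phi> J / c\<^sub>\<Phi> J" using frame_constants_pos[OF \<Phi>_frame[of J]] by simp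
      \<comment> \<open>Monotonicity of products needs a nonnegative \<open>K\<^sub>G\<close>, which
        holds as it dominates \<open>g J * g' J\<close>.\<close>
      show "0 \<le> a * b * K\<^sub>G"
        using a(1) b(1) K\<^sub>G[of J] mult_nonneg_nonneg[OF G_bounds(1,2), of J J] by simp
      show "0 \<le> g J * g' J" by (intro mult_nonneg_nonneg G_bounds)
    qed (use a b K\<^sub>G K\<^sub>\<Phi> in auto)
    finally show ?thesis .
  qed
  moreover
  obtain M0 where M0: "\<And>y u v. y \<in> Y \<Longrightarrow> \<bar>form y (\<D> u) (\<D> v)\<bar> \<le> M0 * norm u * norm v"
    using form_bounded by blast
  \<comment> \<open>Each \<open>h\<close> in \<open>H\<^sub>\<Phi> J\<close> is \<D> u with |u| <= b
    |h| and |h| <= a |u|. The first transfers boundedness at the price of b^2, the second coercivity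
    at the price of a^2; neither depends on \<open>J\<close> or \<open>y\<close>.\<close>
  define M where "M = max 0 M0 * b\<^sup>2"
  define m where "m = c\<^sub>U / a\<^sup>2"
  have M: "0 \<le> M" and m: "0 < m" using constants a(1) by (auto simp: M_def m_def)
  have bounded: "\<bar>form y h h'\<bar> \<le> M * norm h * norm h'"
    if "y \<in> Y" "h \<in> H\<^sub>\<Phi> J" "h' \<in> H\<^sub>\<Phi> J" for y h h' J
  proof -
    from that obtain u v where uv: "h = \<D> u" "h' = \<D> v" unfolding H_eq by auto
    have "M0 * (norm u * norm v) \<le> max 0 M0 * ((b * norm h) * (b * norm h'))"
      unfolding uv using b by (intro mult_mono) auto
    then show ?thesis
      using M0[OF that(1), of u v] by (simp add: uv M_def power2_eq_square mult_ac)
  qed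
  have coercive: "m * (norm h)\<^sup>2 \<le> form y h h" if "y \<in> Y" "h \<in> H\<^sub>\<Phi> J" for y h J
  proof -
    from that obtain u where u: "h = \<D> u" unfolding H_eq by auto
    have "m * (norm h)\<^sup>2 \<le> m * (a * norm u)\<^sup>2"
      using m a(2) by (intro mult_left_mono power_mono) (auto simp: u)
    also have "\<dots> = c\<^sub>U * (norm u)\<^sup>2" using a(1) by (simp add: m_def power_mult_distrib)
    also have "\<dots> \<le> form y h h" using form_equiv[OF that(1)] u by simp
    finally show ?thesis .
  qed
  have "condition_number (N J) (N J) (gram_matrix (form y) (chi J)) \<le> max 1 (M / m * K\<^sub>\<chi>\<^sup>2)"
    if y: "y \<in> Y" for J y
  proof -
    have "bilinear_on (H\<^sub>\<Phi> J) (form y)"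
      using form_bilinear[OF y] D_iso(2) unfolding H_eq bilinear_on_def linear_on_def
      by (meson image_mono subset_UNIV subsetD)
    then have "condition_number (N J) (N J) (gram_matrix (form y) (chi J))
        \<le> max 1 (M / m * (C\<^sub>\<chi> J / c\<^sub>\<chi> J)\<^sup>2)"
      using bounded[OF y] coercive[OF y] M m
      by (intro condition_number_gram_matrix_le[OF chi_frame N_finite H_sub]) auto
    also have "\<dots> \<le> max 1 (M / m * K\<^sub>\<chi>\<^sup>2)"
      using M m K\<^sub>\<chi> frame_constants_pos[OF chi_frame[of J]]
      by (intro max.mono order_refl mult_left_mono power_mono) auto
    finally show ?thesis .
  qed
  ultimately show ?thesis by blast
qed

end
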